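(* Let $m\ge1$, let $G(m,k)$ be the set of $k$-dimensional linear subspaces of $\mathbb{F}_2^{\,m}$, and let $h_m=\mathrm{cwe}(H_8\otimes_{\mathbb{F}_2}\mathbb{F}_{2^m})$. Then $$h_m=\sum_{v\in\mathbb{F}_2^{\,m}}x_v^8+14\sum_{U\in G(m,1)}\sum_{d\in\mathbb{F}_2^{\,m}/U}\prod_{v\in d+U}x_v^4+168\sum_{U\in G(m,2)}\sum_{d\in\mathbb{F}_2^{\,m}/U}\prod_{v\in d+U}x_v^2+1344\sum_{U\in G(m,3)}\sum_{d\in\mathbb{F}_2^{\,m}/U}\prod_{v\in d+U}x_v,$$ where $d$ runs over the cosets of $U$ in $\mathbb{F}_2^{\,m}$.
   Context: $H_8$ is the $[8,4,4]$ binary Hamming code, with generator matrix having rows $00001111$, $00110011$, $01010101$, $11111111$. Fix an $\mathbb{F}_2$-basis $a_1,\dots,a_m$ of $\mathbb{F}_{2^m}$ and identify $f=\sum\varepsilon_ia_i$ with $v=(\varepsilon_1,\dots,\varepsilon_m)\in\mathbb{F}_2^{\,m}$, writing $x_v=x_f$. For a binary linear code $C\subseteq\mathbb{F}_2^N$, $C\otimes_{\mathbb{F}_2}\mathbb{F}_{2^m}$ is its $\mathbb{F}_{2^m}$-span in $\mathbb{F}_{2^m}^N$, and its complete weight enumerator is $\sum_{c}\prod_fx_f^{a_f(c)}$, $a_f(c)$ being the number of coordinates of $c$ equal to $f$. *)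

theory Defs
  imports "HOL-Analysis.Analysis" "HOL-Library.Z2" "HOL-Library.Poly_Mapping"
begin

instance bit :: finite
proof
  have "(UNIV :: bit set) = {0, 1}"
    using bit_not_zero_iff by blast
  then show "finite (UNIV :: bit set)"
    by (metis finite.emptyI finite.insertI)
qed

text \<open>The field with two elements is \<^typ>\<open>bit\<close>, and \<open>\<F>\<^sub>2\<^sup>m\<close> is \<^typ>\<open>bit ^ 'm\<close> with
  \<open>m = CARD('m)\<close>.  The field with \<open>2\<^sup>m\<close> elements is any finite field type \<open>'f\<close> with
  \<open>CARD('f) = 2 ^ CARD('m)\<close>.\<close>

definition H8_generator :: "bit ^ 8 ^ 4" where
  "H8_generator = vector
     [vector [0,0,0,0,1,1,1,1],
      vector [0,0,1,1,0,0,1,1],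
      vector [0,1,0,1,0,1,0,1],
      vector [1,1,1,1,1,1,1,1]]"

definition H8 :: "(bit ^ 8) set" where
  "H8 = vec.span (rows H8_generator)"

text \<open>\<open>C \<otimes> 'f\<close> for a binary code \<open>C\<close>: the \<open>'f\<close>-span of the image of \<open>C\<close> under the
  coordinatewise inclusion \<open>of_bit\<close> of the prime field (meaningful in characteristic 2).\<close>

definition extend_scalars :: "(bit ^ 'n) set \<Rightarrow> ('f::field ^ 'n) set" where
  "extend_scalars C = vec.span ((\<lambda>c. \<chi> i. of_bit (c $ i)) ` C)"

text \<open>Polynomials over the integers in variables indexed by \<open>'v\<close>: finitely supported maps
  from exponent vectors to coefficients, with convolution product.\<close>

type_synonym 'v mpoly_int = "('v \<Rightarrow>\<^sub>0 nat) \<Rightarrow>\<^sub>0 int"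

definition Var :: "'v \<Rightarrow> 'v mpoly_int" where
  "Var f = Poly_Mapping.single (Poly_Mapping.single f 1) 1"

definition cwe :: "('f::finite ^ 'n) set \<Rightarrow> 'f mpoly_int" where
  "cwe C = (\<Sum>c\<in>C. \<Prod>f\<in>UNIV. Var f ^ card {i. c $ i = f})"

definition F2_scale :: "bit \<Rightarrow> 'f::field \<Rightarrow> 'f" where
  "F2_scale e x = of_bit e * x"

definition F2_basis :: "('m::finite \<Rightarrow> 'f::field) \<Rightarrow> bool" where
  "F2_basis a \<longleftrightarrow> inj a \<and> \<not> module.dependent F2_scale (range a)
     \<and> module.span F2_scale (range a) = UNIV"

text \<open>\<^const>\<open>module.span\<close> and \<^const>\<open>module.dependent\<close> have their intended meaning
  because of the following.\<close>

lemma vector_space_F2_scale: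
  assumes "CARD('f::{field,finite}) = 2 ^ n"
  shows "vector_space (F2_scale :: bit \<Rightarrow> 'f \<Rightarrow> 'f)"
proof -
  have "(\<Sum>x\<in>UNIV. x + 1 :: 'f) = (\<Sum>x\<in>UNIV. x)"
    by (rule sum.reindex_bij_witness[where i = "\<lambda>x. x - 1" and j = "\<lambda>x. x + 1"]) auto
  then have "of_nat CARD('f) = (0 :: 'f)"
    by (simp add: sum.distrib)
  then have "(1::'f) + 1 = 0"
    by (simp add: assms)
  then have "x + x = 0" for x :: 'f
    by (metis distrib_right mult_1 mult_zero_left)
  then show ?thesis
    by unfold_locales (auto simp: F2_scale_def algebra_simps of_bool_def split: if_splits)
qed

text \<open>The variable \<open>x\<^sub>v = x\<^sub>f\<close> for \<open>f = \<Sum>\<^sub>i v\<^sub>i a\<^sub>i\<close>.\<close>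

definition Var_vec :: "('m::finite \<Rightarrow> 'f::field) \<Rightarrow> bit ^ 'm \<Rightarrow> 'f mpoly_int" where
  "Var_vec a v = Var (\<Sum>i\<in>UNIV. F2_scale (v $ i) (a i))"

definition Grassmannian :: "nat \<Rightarrow> (bit ^ 'm) set set" where
  "Grassmannian k = {U. vec.subspace U \<and> vec.dim U = k}"

definition cosets :: "(bit ^ 'm) set \<Rightarrow> (bit ^ 'm) set set" where
  "cosets U = range (\<lambda>d. (+) d ` U)"

end

theory Submission
  imports Defs
begin

text \<open>A word of the extended Hamming code is an affine map \<open>j \<mapsto> d + j\<^sub>1 p + j\<^sub>2 q + j\<^sub>3 r\<close> on the cube
  \<open>\<F>\<^sub>2\<^sup>3\<close>.  If \<open>U\<close> is the span of \<open>p, q, r\<close> and has dimension \<open>k\<close>, the word takes each value in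
  \<open>d + U\<close> exactly \<open>2\<^bsup>3 - k\<^esup>\<close> times.  The number of triples spanning a given \<open>U\<close> is 1, 7, 42, 168 for
  \<open>k = 0, 1, 2, 3\<close>, and each coset of \<open>U\<close> arises from \<open>2\<^sup>k\<close> values of \<open>d\<close>; this gives the
  coefficients 1, 14, 168, 1344.\<close>

section \<open>Binary subspaces and their cosets\<close>

text \<open>The coefficient of \<open>p\<close> can only be 0 or 1, so adjoining \<open>p\<close>
  adds a single translate of the old span.\<close>

lemma bit_span_insert:
  "vec.span (insert p S) = vec.span S \<union> (+) p ` vec.span (S :: (bit ^ 'n) set)"
proof -
  have "x \<in> vec.span (insert p S) \<longleftrightarrow> x \<in> vec.span S \<or> x - p \<in> vec.span S" for x
    unfolding vec.span_breakdown_eq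
  proof
    assume "\<exists>k. x - k *s p \<in> vec.span S"
    then obtain k where "x - k *s p \<in> vec.span S" ..
    then show "x \<in> vec.span S \<or> x - p \<in> vec.span S" by (cases k) auto
  next
    assume "x \<in> vec.span S \<or> x - p \<in> vec.span S"
    then have "x - 0 *s p \<in> vec.span S \<or> x - 1 *s p \<in> vec.span S" by simp
    then show "\<exists>k. x - k *s p \<in> vec.span S" by blast
  qed
  moreover have "x - p \<in> T \<longleftrightarrow> x \<in> (+) p ` T" for x and T :: "(bit ^ 'n) set"
    by (auto simp: image_iff intro: bexI[of _ "x - p"])
  ultimately show ?thesis by blast
qed

lemma coset_disjoint:
  fixes U :: "(bit ^ 'n) set"
  assumes "vec.subspace U" "p \<notin> U"
  shows "(+) d ` U \<inter> (+) (d + p) ` U = {}"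
proof -
  have False if "u \<in> U" "w \<in> U" "d + u = d + p + w" for u w
  proof -
    have "p = u - w" using that(3) by (simp add: algebra_simps)
    then show False using that assms vec.subspace_diff by blast
  qed
  then show ?thesis by blast
qed

lemma coset_absorb:
  fixes U :: "(bit ^ 'n) set"
  assumes "vec.subspace U" "p \<in> U"
  shows "(+) (d + p) ` U = (+) d ` U"
proof (intro equalityI subsetI)
  fix x assume "x \<in> (+) (d + p) ` U"
  then obtain u where "u \<in> U" "x = d + (p + u)" by (auto simp: add.assoc)
  then show "x \<in> (+) d ` U" using assms vec.subspace_add by blast
next
  fix x assume "x \<in> (+) d ` U"
  then obtain u where "u \<in> U" "x = d + p + (u - p)" by auto
  then show "x \<in> (+) (d + p) ` U" using assms vec.subspace_diff by blast
qed

text \<open>Each vector outside the span of the earlier ones doubles the span, because the added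
  translate is disjoint from it.\<close>

lemma card_bit_span:
  "card (vec.span S) = 2 ^ vec.dim (S :: (bit ^ 'n) set)"
proof -
  have "finite S" by simp
  then show ?thesis
  proof (induction S)
    case empty
    then show ?case by simp
  next
    case (insert p S)
    show ?case
    proof (cases "p \<in> vec.span S")
      case True
      then show ?thesis using insert.IH by (simp add: vec.span_redundant vec.dim_insert)
    next
      case False
      have "vec.span S \<inter> (+) p ` vec.span S = {}"
        using coset_disjoint[OF vec.subspace_span False, of 0] by simp
      then show ?thesis
        using insert.IH False
        by (simp add: bit_span_insert card_Un_disjoint card_image vec.dim_insert)
    qed
  qed
qed

lemma card_bit_subspace:
  "vec.subspace U \<Longrightarrow> card U = 2 ^ vec.dim (U :: (bit ^ 'n) set)"
  by (metis card_bit_span vec.span_eq_iff)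

section \<open>Counting spanning tuples\<close>

text \<open>\<open>num_spanning_ext n w k\<close> counts the \<open>n\<close>-tuples that together with a given
  \<open>w\<close>-dimensional subspace span a given \<open>k\<close>-dimensional one.  The recursion distinguishes
  whether the first entry lies in the smaller space.\<close>

fun num_spanning_ext :: "nat \<Rightarrow> nat \<Rightarrow> nat \<Rightarrow> nat" where
  "num_spanning_ext 0 w k = (if w = k then 1 else 0)"
| "num_spanning_ext (Suc n) w k =
    2 ^ w * num_spanning_ext n w k + (2 ^ k - 2 ^ w) * num_spanning_ext n (Suc w) k"

text \<open>These are the numbers of linear surjections from a 3-dimensional binary space onto one
  of dimension 0, 1, 2, 3: 1, 7, 7 * 6 and 7 * 6 * 4.\<close>

lemma num_spanning_ext_3:
  "num_spanning_ext 3 0 0 = 1" "num_spanning_ext 3 0 (Suc 0) = 7"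
  "num_spanning_ext 3 0 2 = 42" "num_spanning_ext 3 0 3 = 168"
  by (simp_all add: numeral_3_eq_3)

text \<open>Moving the head of the tuple into \<open>W\<close> gives the recursion, so the induction
  lets \<open>W\<close> vary over subsets of \<open>U\<close>; the plain count of spanning tuples is
  the case of empty \<open>W\<close>.\<close>

lemma card_spanning_ext:
  fixes U W :: "(bit ^ 'n) set"
  assumes "vec.subspace U" "W \<subseteq> U"
  shows "card {xs. length xs = n \<and> vec.span (W \<union> set xs) = U}
    = num_spanning_ext n (vec.dim W) (vec.dim U)"
  using assms(2)
proof (induction n arbitrary: W)
  case 0
  \<comment> \<open>Inside \<open>U\<close>, equal dimension forces equal span.\<close>
  have "vec.span W = U \<longleftrightarrow> vec.dim W = vec.dim U"
  proof
    assume "vec.dim W = vec.dim U"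
    then have "vec.span W = vec.span U" using 0 by (intro vec.dim_eq_span) auto
    then show "vec.span W = U" using assms(1) by (simp add: vec.span_eq_iff[THEN iffD2])
  qed (metis vec.dim_span)
  then have "{xs. length xs = 0 \<and> vec.span (W \<union> set xs) = U}
     = {xs. xs = [] \<and> vec.dim W = vec.dim U}"
    by (intro Collect_cong) (simp cong: conj_cong)
  then show ?case by simp
next
  case (Suc n)
  let ?A = "\<lambda>W. {xs. length xs = n \<and> vec.span (W \<union> set xs) = U}"
  have span: "vec.span W \<subseteq> U" using Suc.prems assms(1) by (rule vec.span_minimal)
  have fin: "finite (?A W)" for W
    by (rule finite_subset[OF _ finite_lists_length_eq[of UNIV n]]) auto
  have "{xs. length xs = Suc n \<and> vec.span (W \<union> set xs) = U}
     = (\<lambda>(x, xs). x # xs) ` (SIGMA x:U. ?A (insert x W))" (is "?L = ?R")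
  proof (intro equalityI subsetI)
    fix ys assume ys: "ys \<in> ?L"
    then obtain x xs where x: "ys = x # xs" by (cases ys) simp_all
    have "x \<in> vec.span (W \<union> set ys)" unfolding x by (rule vec.span_base) simp
    then have "x \<in> U" using ys by simp
    moreover have "xs \<in> ?A (insert x W)" using ys x by simp
    ultimately show "ys \<in> ?R" unfolding x by blast
  next
    fix ys assume "ys \<in> ?R"
    then show "ys \<in> ?L" by (elim imageE SigmaE) simp
  qed
  then have "card ?L = card (SIGMA x:U. ?A (insert x W))"
    by (simp add: card_image inj_on_def split_def prod_eq_iff)
  also have "\<dots> = (\<Sum>x\<in>U. card (?A (insert x W)))"
    by (rule card_SigmaI) (simp, use fin in blast)
  also have "\<dots> = (\<Sum>x\<in>U. if x \<in> vec.span W then num_spanning_ext n (vec.dim W) (vec.dim U)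
      else num_spanning_ext n (Suc (vec.dim W)) (vec.dim U))"
  proof (rule sum.cong)
    fix x assume "x \<in> U"
    then show "card (?A (insert x W)) =
        (if x \<in> vec.span W then num_spanning_ext n (vec.dim W) (vec.dim U)
         else num_spanning_ext n (Suc (vec.dim W)) (vec.dim U))"
      using Suc.IH[of "insert x W"] Suc.prems by (simp add: vec.dim_insert)
  qed simp
  also have "\<dots> = card (vec.span W) * num_spanning_ext n (vec.dim W) (vec.dim U)
      + (card U - card (vec.span W)) * num_spanning_ext n (Suc (vec.dim W)) (vec.dim U)"
    using span by (subst sum.If_cases) (auto simp: Int_absorb1 Diff_eq[symmetric] card_Diff_subset
        Int_absorb2 Collect_mem_eq)
  also have "card U = 2 ^ vec.dim U"
    using assms(1) by (rule card_bit_subspace)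
  finally show ?case by (simp add: card_bit_span)
qed

section \<open>Products over affine cubes\<close>

text \<open>One factor for each sublist of \<open>ps\<close>, evaluated at \<open>d\<close> plus the
  sum of that sublist; coinciding points count with multiplicity.\<close>

fun cube_prod :: "('v::plus \<Rightarrow> 'r::comm_monoid_mult) \<Rightarrow> 'v list \<Rightarrow> 'v \<Rightarrow> 'r" where
  "cube_prod x [] d = x d"
| "cube_prod x (p # ps) d = cube_prod x ps d * cube_prod x ps (d + p)"

text \<open>A new direction inside the span repeats the same coset, which doubles the exponent; one
  outside adds a disjoint coset with the same exponent.\<close>

lemma cube_prod_eq_coset_prod:
  fixes x :: "bit ^ 'n \<Rightarrow> 'r::comm_semiring_1"
  shows "cube_prod x ps d =
    (\<Prod>v\<in>(+) d ` vec.span (set ps). x v ^ 2 ^ (length ps - vec.dim (set ps)))"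
proof (induction ps arbitrary: d)
  case Nil
  then show ?case by simp
next
  case (Cons p ps)
  \<comment> \<open>Keeps the natural-number subtraction in the exponent from truncating.\<close>
  have le: "vec.dim (set ps) \<le> length ps"
    using vec.dim_le_card'[of "set ps"] card_length[of ps] by simp
  show ?case
  proof (cases "p \<in> vec.span (set ps)")
    case True
    let ?e = "2 ^ (length ps - vec.dim (set ps)) :: nat"
    let ?P = "\<lambda>e. \<Prod>v\<in>(+) d ` vec.span (set ps). x v ^ e"
    have "cube_prod x (p # ps) d = ?P ?e * ?P ?e"
      by (simp only: cube_prod.simps Cons.IH coset_absorb[OF vec.subspace_span True])
    also have "\<dots> = ?P (2 * ?e)"
      by (simp only: prod.distrib[symmetric] mult_2 power_add)
    also have "2 * ?e = 2 ^ (length (p # ps) - vec.dim (set (p # ps)))"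
      using le True by (simp add: vec.dim_insert Suc_diff_le)
    finally show ?thesis
      using True by (simp add: vec.span_redundant)
  next
    case False
    have "(+) d ` vec.span (set (p # ps))
        = (+) d ` vec.span (set ps) \<union> (+) (d + p) ` vec.span (set ps)"
      by (simp add: bit_span_insert image_Un image_image add.assoc)
    moreover have "vec.dim (set (p # ps)) = Suc (vec.dim (set ps))"
      using False by (simp add: vec.dim_insert)
    ultimately show ?thesis
      using coset_disjoint[OF vec.subspace_span False, of d]
      by (simp only: cube_prod.simps Cons.IH list.size(4) add_Suc_right add_0_right diff_Suc_Suc)
        (subst prod.union_disjoint, auto)
  qed
qed

text \<open>The fibre of \<open>d \<mapsto> d + U\<close> over a coset is that coset itself, which
  has \<open>2 ^ vec.dim U\<close> elements.\<close>

lemma sum_translates_eq_sum_cosets: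
  fixes U :: "(bit ^ 'n) set" and f :: "(bit ^ 'n) set \<Rightarrow> 'r::comm_semiring_1"
  assumes "vec.subspace U"
  shows "(\<Sum>d\<in>UNIV. f ((+) d ` U)) = of_nat (2 ^ vec.dim U) * (\<Sum>D\<in>cosets U. f D)"
proof -
  have fib: "{d. (+) d ` U = (+) e ` U} = (+) e ` U" for e
  proof (intro equalityI subsetI)
    fix d assume "d \<in> {d. (+) d ` U = (+) e ` U}"
    moreover have "d \<in> (+) d ` U" using vec.subspace_0[OF assms] by force
    ultimately show "d \<in> (+) e ` U" by simp
  next
    fix d assume "d \<in> (+) e ` U"
    then obtain u where "u \<in> U" "d = e + u" by blast
    then show "d \<in> {d. (+) d ` U = (+) e ` U}" by (simp add: coset_absorb[OF assms])
  qed
  have "(\<Sum>d\<in>UNIV. f ((+) d ` U)) = (\<Sum>D\<in>cosets U. \<Sum>d\<in>{d. (+) d ` U = D}. f ((+) d ` U))"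
    unfolding cosets_def by (subst sum.image_gen[where g = "\<lambda>d. (+) d ` U"]) auto
  also have "\<dots> = (\<Sum>D\<in>cosets U. of_nat (2 ^ vec.dim U) * f D)"
  proof (rule sum.cong)
    fix D assume "D \<in> cosets U"
    then obtain e where D: "D = (+) e ` U" by (auto simp: cosets_def)
    then have "card {d. (+) d ` U = D} = 2 ^ vec.dim U"
      by (simp add: fib card_image card_bit_subspace[OF assms])
    then show "(\<Sum>d\<in>{d. (+) d ` U = D}. f ((+) d ` U)) = of_nat (2 ^ vec.dim U) * f D"
      by simp
  qed simp
  finally show ?thesis by (simp add: sum_distrib_left)
qed

text \<open>Tuples are grouped by their span \<open>U\<close>. The first factor of the coefficient
  counts the tuples spanning \<open>U\<close>, the second the base points of each coset.\<close>

lemma sum_cube_prod: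
  fixes x :: "bit ^ 'n \<Rightarrow> 'r::comm_semiring_1"
  shows "(\<Sum>ps | length ps = n. \<Sum>d\<in>UNIV. cube_prod x ps d) =
    (\<Sum>k\<le>n. of_nat (num_spanning_ext n 0 k * 2 ^ k) *
      (\<Sum>U\<in>Grassmannian k. \<Sum>D\<in>cosets U. \<Prod>v\<in>D. x v ^ 2 ^ (n - k)))"
proof -
  let ?L = "{ps :: (bit ^ 'n) list. length ps = n}"
  \<comment> \<open>Stopping at \<open>n\<close> is enough, since \<open>n\<close> vectors span at
    most dimension \<open>n\<close>.\<close>
  let ?S = "\<Union>k\<le>n. Grassmannian k :: (bit ^ 'n) set set"
  let ?F = "\<lambda>k U. of_nat (2 ^ k) * (\<Sum>D\<in>cosets U. \<Prod>v\<in>D. x v ^ 2 ^ (n - k))"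
  have fin: "finite ?L"
    using finite_lists_length_eq[of "UNIV :: (bit ^ 'n) set" n] by simp
  have "vec.span (set ps) \<in> ?S" if "length ps = n" for ps :: "(bit ^ 'n) list"
  proof -
    have "vec.dim (set ps) \<le> n"
      using vec.dim_le_card'[of "set ps"] card_length[of ps] that by simp
    then show ?thesis by (simp add: Grassmannian_def vec.subspace_span vec.dim_span)
  qed
  then have sub: "(\<lambda>ps. vec.span (set ps)) ` ?L \<subseteq> ?S" by blast
  have "(\<Sum>ps\<in>?L. \<Sum>d\<in>UNIV. cube_prod x ps d)
      = (\<Sum>ps\<in>?L. ?F (vec.dim (vec.span (set ps))) (vec.span (set ps)))"
  proof (rule sum.cong)
    fix ps assume "ps \<in> ?L"
    then show "(\<Sum>d\<in>UNIV. cube_prod x ps d)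
        = ?F (vec.dim (vec.span (set ps))) (vec.span (set ps))"
      using sum_translates_eq_sum_cosets[OF vec.subspace_span,
          of "\<lambda>D. \<Prod>v\<in>D. x v ^ 2 ^ (n - vec.dim (set ps))" "set ps"]
      by (simp add: cube_prod_eq_coset_prod vec.dim_span)
  qed simp
  also have "\<dots> = (\<Sum>U\<in>?S. \<Sum>ps | ps \<in> ?L \<and> vec.span (set ps) = U.
      ?F (vec.dim (vec.span (set ps))) (vec.span (set ps)))"
    by (rule sum.group[OF fin _ sub, symmetric]) simp
  also have "\<dots> = (\<Sum>U\<in>?S. of_nat (num_spanning_ext n 0 (vec.dim U)) * ?F (vec.dim U) U)"
  proof (rule sum.cong)
    fix U assume "U \<in> ?S"
    then have U: "vec.subspace U" by (auto simp: Grassmannian_def)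
    \<comment> \<open>The empty union brings the index set into the form of
      \<open>card_spanning_ext\<close> with \<open>W\<close> empty.\<close>
    have "(\<Sum>ps | ps \<in> ?L \<and> vec.span (set ps) = U.
        ?F (vec.dim (vec.span (set ps))) (vec.span (set ps)))
      = (\<Sum>ps | length ps = n \<and> vec.span ({} \<union> set ps) = U. ?F (vec.dim U) U)"
      by (rule sum.cong) auto
    also have "\<dots> = of_nat (num_spanning_ext n 0 (vec.dim U)) * ?F (vec.dim U) U"
      by (simp only: sum_constant card_spanning_ext[OF U empty_subsetI] vec.dim_empty)
    finally show "(\<Sum>ps | ps \<in> ?L \<and> vec.span (set ps) = U.
        ?F (vec.dim (vec.span (set ps))) (vec.span (set ps))) = \<dots>" .
  qed simp
  also have "\<dots> = (\<Sum>k\<le>n. \<Sum>U\<in>Grassmannian k.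
      of_nat (num_spanning_ext n 0 (vec.dim U)) * ?F (vec.dim U) U)"
    by (rule sum.UNION_disjoint) (auto simp: Grassmannian_def)
  also have "\<dots> = (\<Sum>k\<le>n. \<Sum>U\<in>Grassmannian k. of_nat (num_spanning_ext n 0 k) * ?F k U)"
    by (intro sum.cong refl) (auto simp: Grassmannian_def)
  finally show ?thesis
    by (simp add: sum_distrib_left mult.assoc)
qed

text \<open>The only subspace of dimension 0 is \<open>{0}\<close>, whose cosets are singletons;
  this produces the eighth powers in the final formula.\<close>

lemma sum_cosets_Grassmannian_0:
  "(\<Sum>U\<in>Grassmannian 0. \<Sum>D\<in>cosets U. \<Prod>v\<in>D. f v) = (\<Sum>v\<in>(UNIV :: (bit ^ 'n) set). f v)"
proof -
  have "U = {0}" if "vec.subspace U" "vec.dim U = 0" for U :: "(bit ^ 'n) set"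
    using that vec.subspace_0[OF that(1)] by auto
  then have "Grassmannian 0 = {{0 :: bit ^ 'n}}"
    by (auto simp: Grassmannian_def vec.subspace_single_0)
  moreover have "cosets {0 :: bit ^ 'n} = range (\<lambda>d. {d})"
    by (simp add: cosets_def)
  ultimately show ?thesis
    by (simp add: sum.reindex inj_on_def)
qed

lemma sum_lists_3:
  fixes f :: "'a::finite list \<Rightarrow> 'r::comm_monoid_add"
  shows "(\<Sum>ps | length ps = 3. f ps) = (\<Sum>(p, q, r)\<in>UNIV. f [p, q, r])"
  by (rule sum.reindex_bij_witness[where i = "\<lambda>(p, q, r). [p, q, r]"
        and j = "\<lambda>ps. (ps ! 0, ps ! 1, ps ! 2)"])
    (auto simp: length_Suc_conv numeral_3_eq_3 numeral_2_eq_2)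

section \<open>Weight enumerators and extension of scalars\<close>

text \<open>Grouping the coordinates of a word by their value turns the product over coordinates
  into the defining one.\<close>

lemma cwe_altdef:
  "cwe (C :: ('f::finite ^ 'n) set) = (\<Sum>c\<in>C. \<Prod>i\<in>UNIV. Var (c $ i))"
proof -
  have "(\<Prod>f\<in>UNIV. Var f ^ card {i. c $ i = f}) = (\<Prod>i\<in>UNIV. Var (c $ i))"
    for c :: "'f ^ 'n"
  proof -
    have "(\<Prod>i\<in>UNIV. Var (c $ i)) = (\<Prod>f\<in>UNIV. \<Prod>i | i \<in> UNIV \<and> c $ i = f. Var (c $ i))"
      by (rule prod.group[symmetric]) auto
    then show ?thesis by simp
  qed
  then show ?thesis by (simp add: cwe_def)
qed

text \<open>In characteristic 2 the coordinatewise inclusion is additive, so it sends the binary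
  span of \<open>S\<close> into the span of the image of \<open>S\<close>; generators of the code
  therefore suffice.\<close>

lemma extend_scalars_span:
  assumes "(1::'f::field) + 1 = 0"
  shows "(extend_scalars (vec.span S) :: ('f ^ 'n) set)
    = vec.span ((\<lambda>c. \<chi> i. of_bit (c $ i)) ` S)"
proof -
  let ?\<iota> = "\<lambda>c :: bit ^ 'n. (\<chi> i. of_bit (c $ i)) :: 'f ^ 'n"
  have add: "?\<iota> (c + d) = ?\<iota> c + ?\<iota> d" for c d
    using assms by (auto simp: vec_eq_iff of_bool_def)
  have scale: "?\<iota> (k *s c) = of_bit k *s ?\<iota> c" for k c
    by (auto simp: vec_eq_iff)
  have "?\<iota> c \<in> vec.span (?\<iota> ` S)" if "c \<in> vec.span S" for c
    using that
  proof (induction rule: vec.span_induct_alt)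
    case base
    have "?\<iota> 0 = 0" by (simp add: vec_eq_iff)
    then show ?case by (simp only: vec.span_zero)
  next
    case (step k x y)
    then show ?case
      unfolding add scale by (rule vec.span_add[OF vec.span_scale[OF vec.span_base[OF imageI]]])
  qed
  then have "vec.span (?\<iota> ` vec.span S) \<subseteq> vec.span (?\<iota> ` S)"
    by (intro vec.span_minimal vec.subspace_span) blast
  moreover have "vec.span (?\<iota> ` S) \<subseteq> vec.span (?\<iota> ` vec.span S)"
    by (intro vec.span_mono image_mono vec.span_superset)
  ultimately show ?thesis
    unfolding extend_scalars_def by (rule equalityI)
qed

section \<open>Codewords of the extended Hamming code\<close>

lemma UNIV_8: "(UNIV :: 8 set) = {1, 2, 3, 4, 5, 6, 7, 8}"
proof -
  have "card {1, 2, 3, 4, 5, 6, 7, 8 :: 8} = CARD(8)" by simp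
  then show ?thesis by (intro card_subset_eq[symmetric]) simp_all
qed

lemma prod_8: "prod f (UNIV :: 8 set) = f 1 * (f 2 * (f 3 * (f 4 * (f 5 * (f 6 * (f 7 * f 8))))))"
  unfolding UNIV_8 by simp

lemma vector_4 [simp]:
  fixes v1 v2 v3 v4 :: "'a::zero"
  defines "w \<equiv> vector [v1, v2, v3, v4] :: 'a ^ 4"
  shows "w $ 1 = v1" "w $ 2 = v2" "w $ 3 = v3" "w $ 4 = v4"
  unfolding w_def vector_def by simp_all

lemma vector_8 [simp]:
  fixes v1 v2 v3 v4 v5 v6 v7 v8 :: "'a::zero"
  defines "w \<equiv> vector [v1, v2, v3, v4, v5, v6, v7, v8] :: 'a ^ 8"
  shows "w $ 1 = v1" "w $ 2 = v2" "w $ 3 = v3" "w $ 4 = v4"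
    "w $ 5 = v5" "w $ 6 = v6" "w $ 7 = v7" "w $ 8 = v8"
  unfolding w_def vector_def by simp_all

text \<open>The first three entries of the columns of \<open>H8_generator\<close> are the binary
  digits of 0 to 7, and the fourth is 1; \<open>p\<close>, \<open>q\<close>, \<open>r\<close>,
  \<open>d\<close> are the coefficients of the four rows.\<close>

definition H8_word :: "'f::field \<Rightarrow> 'f \<Rightarrow> 'f \<Rightarrow> 'f \<Rightarrow> 'f ^ 8" where
  "H8_word p q r d = vector
     [d, d + r, d + q, d + q + r, d + p, d + p + r, d + p + q, d + p + q + r]"

lemma extend_scalars_H8:
  assumes "(1::'f::field) + 1 = 0"
  shows "(extend_scalars H8 :: ('f ^ 8) set) = {H8_word p q r d | p q r d. True}"
proof -
  let ?\<iota> = "\<lambda>c :: bit ^ 8. (\<chi> i. of_bit (c $ i)) :: 'f ^ 8"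
  define w1 w2 w3 w4 :: "'f ^ 8"
    where "w1 = vector [0,0,0,0,1,1,1,1]" and "w2 = vector [0,0,1,1,0,0,1,1]"
      and "w3 = vector [0,1,0,1,0,1,0,1]" and "w4 = vector [1,1,1,1,1,1,1,1]"
  have "rows H8_generator = {H8_generator $ 1, H8_generator $ 2, H8_generator $ 3, H8_generator $ 4}"
    by (auto simp: rows_def row_def UNIV_4 setcompr_eq_image)
  moreover have "?\<iota> (H8_generator $ 1) = w1" "?\<iota> (H8_generator $ 2) = w2"
      "?\<iota> (H8_generator $ 3) = w3" "?\<iota> (H8_generator $ 4) = w4"
    by (simp_all add: H8_generator_def w1_def w2_def w3_def w4_def vec_eq_iff
        ball_UNIV[symmetric] UNIV_8 del: ball_UNIV)
  ultimately have "?\<iota> ` rows H8_generator = {w1, w2, w3, w4}" by simp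
  then have "extend_scalars H8 = vec.span {w1, w2, w3, w4}"
    unfolding H8_def by (simp add: extend_scalars_span[OF assms])
  also have "\<dots> = {p *s w1 + q *s w2 + r *s w3 + d *s w4 | p q r d. True}"
    by (simp add: vec.span_breakdown_eq set_eq_iff algebra_simps)
  finally have "extend_scalars H8 = {p *s w1 + q *s w2 + r *s w3 + d *s w4 | p q r d. True}" .
  moreover have "p *s w1 + q *s w2 + r *s w3 + d *s w4 = H8_word p q r d" for p q r d
    by (simp add: H8_word_def w1_def w2_def w3_def w4_def vec_eq_iff algebra_simps
        ball_UNIV[symmetric] UNIV_8 del: ball_UNIV)
  ultimately show ?thesis by simp
qed

lemma H8_word_eq_iff:
  "H8_word p q r d = H8_word p' q' r' d' \<longleftrightarrow> p = p' \<and> q = q' \<and> r = r' \<and> d = d'"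
proof
  assume "H8_word p q r d = H8_word p' q' r' d'"
  then have "H8_word p q r d $ i = H8_word p' q' r' d' $ i" for i by simp
  \<comment> \<open>These coordinates are \<open>d\<close>, \<open>d + r\<close>,
    \<open>d + q\<close>, \<open>d + p\<close>, from which all four parameters are
    recovered.\<close>
  from this[of 1] this[of 2] this[of 3] this[of 5]
  show "p = p' \<and> q = q' \<and> r = r' \<and> d = d'" by (simp add: H8_word_def)
qed simp

text \<open>The coordinates of \<open>H8_word\<close> come in the order in which
  \<open>cube_prod\<close> lists its factors, so associativity is enough to match them.\<close>

lemma prod_H8_word:
  assumes "\<And>u v. \<phi> (u + v) = \<phi> u + \<phi> v"
  shows "(\<Prod>i\<in>UNIV. X (H8_word (\<phi> p) (\<phi> q) (\<phi> r) (\<phi> d) $ i))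
    = cube_prod (\<lambda>v. X (\<phi> v)) [p, q, r] (d :: 'v::ab_semigroup_add)"
  by (simp only: prod_8 H8_word_def vector_8 cube_prod.simps assms mult.assoc)

section \<open>Coordinates and the final identity\<close>

text \<open>Surjectivity comes from spanning, and injectivity then from equal finite
  cardinalities.\<close>

lemma F2_basis_coordinates:
  fixes a :: "'m::finite \<Rightarrow> 'f::{field,finite}"
  assumes "CARD('f) = 2 ^ CARD('m)" "F2_basis a"
  defines "\<phi> \<equiv> \<lambda>v :: bit ^ 'm. \<Sum>i\<in>UNIV. F2_scale (v $ i) (a i)"
  shows "bij \<phi>" and "\<phi> (u + v) = \<phi> u + \<phi> v"
proof -
  interpret vector_space "F2_scale :: bit \<Rightarrow> 'f \<Rightarrow> 'f"
    by (rule vector_space_F2_scale[OF assms(1)])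
  show "\<phi> (u + v) = \<phi> u + \<phi> v"
    by (simp only: \<phi>_def vector_add_component scale_left_distrib sum.distrib)
  have "surj \<phi>"
    unfolding surj_def
  proof
    fix y :: 'f
    have "y \<in> span (range a)" using assms(2) by (simp add: F2_basis_def)
    then obtain u where "y = (\<Sum>x\<in>range a. F2_scale (u x) x)"
      by (auto simp: span_finite)
    also have "\<dots> = \<phi> (\<chi> i. u (a i))"
      \<comment> \<open>Injectivity of \<open>a\<close> turns the sum over \<open>range a\<close>
        into one over indices.\<close>
      using assms(2) by (simp add: \<phi>_def F2_basis_def sum.reindex)
    finally show "\<exists>v. y = \<phi> v" ..
  qed
  moreover have "CARD(bit ^ 'm) = CARD('f)"
  proof -
    have "(UNIV :: bit set) = {0, 1}" using bit_not_zero_iff by blast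
    then have "CARD(bit) = 2" by (metis card_2_iff zero_neq_one)
    then show ?thesis by (simp add: assms(1))
  qed
  ultimately show "bij \<phi>"
    by (simp add: bij_def eq_card_imp_inj_on)
qed

theorem theorem4p14:
  fixes a :: "'m::finite \<Rightarrow> 'f::{field,finite}"
  assumes "CARD('f) = 2 ^ CARD('m)"
    and "F2_basis a"
  shows "cwe (extend_scalars H8 :: ('f ^ 8) set) =
      (\<Sum>v\<in>(UNIV :: (bit ^ 'm) set). Var_vec a v ^ 8)
    + 14 * (\<Sum>U\<in>Grassmannian 1. \<Sum>D\<in>cosets U. \<Prod>v\<in>D. Var_vec a v ^ 4)
    + 168 * (\<Sum>U\<in>Grassmannian 2. \<Sum>D\<in>cosets U. \<Prod>v\<in>D. Var_vec a v ^ 2)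
    + 1344 * (\<Sum>U\<in>Grassmannian 3. \<Sum>D\<in>cosets U. \<Prod>v\<in>D. Var_vec a v)"
proof -
  define \<phi> where "\<phi> = (\<lambda>v :: bit ^ 'm. \<Sum>i\<in>UNIV. F2_scale (v $ i) (a i))"
  have bij: "bij \<phi>" and add: "\<And>u v. \<phi> (u + v) = \<phi> u + \<phi> v"
    unfolding \<phi>_def by (rule F2_basis_coordinates[OF assms])+
  have inj: "\<phi> u = \<phi> v \<longleftrightarrow> u = v" for u v
    using bij by (simp add: bij_def inj_eq)
  interpret vector_space "F2_scale :: bit \<Rightarrow> 'f \<Rightarrow> 'f"
    by (rule vector_space_F2_scale[OF assms(1)])
  \<comment> \<open>Distributivity of \<open>F2_scale\<close> carries \<open>1 + 1 = 0\<close> from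
    \<open>bit\<close> to the big field.\<close>
  have "(1::'f) + 1 = 0"
    using scale_left_distrib[of 1 1 "1::'f"] by (simp add: F2_scale_def)
  \<comment> \<open>Words are indexed by binary vectors through \<open>\<phi>\<close>, with the
    directions paired apart from the base point so that the sum over \<open>d\<close> can be split
    off.\<close>
  then have C: "(extend_scalars H8 :: ('f ^ 8) set)
      = (\<lambda>((p, q, r), d). H8_word (\<phi> p) (\<phi> q) (\<phi> r) (\<phi> d)) ` UNIV" (is "_ = ?h ` UNIV")
  proof -
    have "c \<in> range ?h" if "c = H8_word p q r d" for c p q r d
    proof -
      have "c = ?h ((inv \<phi> p, inv \<phi> q, inv \<phi> r), inv \<phi> d)"
        using that bij by (simp add: bij_def surj_f_inv_f)
      then show ?thesis by (rule range_eqI)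
    qed
    then show ?thesis
      using extend_scalars_H8[OF \<open>1 + 1 = 0\<close>] by auto
  qed
  have Var: "Var_vec a = (\<lambda>v. Var (\<phi> v))"
    by (simp add: fun_eq_iff Var_vec_def \<phi>_def)
  \<comment> \<open>Each codeword is thus counted exactly once when the sum is reindexed.\<close>
  have "inj ?h" by (auto simp: inj_def H8_word_eq_iff inj)
  then have "cwe (extend_scalars H8 :: ('f ^ 8) set)
      = (\<Sum>((p, q, r), d)\<in>UNIV. cube_prod (Var_vec a) [p, q, r] d)"
    unfolding cwe_altdef C
    by (simp add: sum.reindex case_prod_unfold prod_H8_word[OF add] Var
        del: cube_prod.simps)
  also have "\<dots> = (\<Sum>(p, q, r)\<in>UNIV. \<Sum>d\<in>UNIV. cube_prod (Var_vec a) [p, q, r] d)"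
    by (simp add: sum.cartesian_product case_prod_unfold del: cube_prod.simps)
  also have "\<dots> = (\<Sum>ps | length ps = 3. \<Sum>d\<in>UNIV. cube_prod (Var_vec a) ps d)"
    by (rule sum_lists_3[symmetric])
  also have "\<dots> = (\<Sum>k\<le>3. of_nat (num_spanning_ext 3 0 k * 2 ^ k) *
      (\<Sum>U\<in>Grassmannian k. \<Sum>D\<in>cosets U. \<Prod>v\<in>D. Var_vec a v ^ 2 ^ (3 - k)))"
    by (rule sum_cube_prod)
  also have "{..3::nat} = {0, 1, 2, 3}" by auto
  finally show ?thesis
    by (simp add: num_spanning_ext_3 sum_cosets_Grassmannian_0 add.assoc del: num_spanning_ext.simps)
qed

end
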